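(* The set of ideals without the Grothendieck property is cofinal in the Rudin–Keisler order (and in the Katětov order): for every ideal $\mathcal I$ on $\omega$ there is an ideal $\mathcal J$ on $\omega$ which is not Grothendieck and satisfies $\mathcal I\le_{RK}\mathcal J$ (respectively $\mathcal I\le_K\mathcal J$).
   Context: All ideals on $\omega$ are proper and contain all finite sets. For ideals $\mathcal I,\mathcal J$ on $\omega$: $\mathcal I\le_K\mathcal J$ (Katětov order) if there is $f:\omega\to\omega$ with $f^{-1}(A)\in\mathcal J$ for every $A\in\mathcal I$; $\mathcal I\le_{RK}\mathcal J$ (Rudin–Keisler order) if there is $f:\omega\to\omega$ such that for every $A\subseteq\omega$, $A\in\mathcal I$ if and only if $f^{-1}(A)\in\mathcal J$. An ideal $\mathcal I$ is Grothendieck if the Banach space $c_{0,\mathcal I}=\{(x_n)\in\ell_\infty:\ \forall\epsilon>0\ \{n:|x_n|\ge\epsilon\}\in\mathcal I\}$ (supremum norm) is Grothendieck, i.e. every weak$^*$ null sequence in its dual is weakly null. *)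

theory Defs
  imports "HOL-Analysis.Analysis"
begin

definition omega_ideal :: "nat set set \<Rightarrow> bool" where
  "omega_ideal I \<longleftrightarrow>
     (\<forall>A. finite A \<longrightarrow> A \<in> I) \<and>
     (\<forall>A B. A \<in> I \<longrightarrow> B \<subseteq> A \<longrightarrow> B \<in> I) \<and>
     (\<forall>A B. A \<in> I \<longrightarrow> B \<in> I \<longrightarrow> A \<union> B \<in> I) \<and>
     UNIV \<notin> I"

definition katetov_le :: "nat set set \<Rightarrow> nat set set \<Rightarrow> bool" where
  "katetov_le I J \<longleftrightarrow> (\<exists>f :: nat \<Rightarrow> nat. \<forall>A \<in> I. f -` A \<in> J)"

definition rudin_keisler_le :: "nat set set \<Rightarrow> nat set set \<Rightarrow> bool" where
  "rudin_keisler_le I J \<longleftrightarrow> (\<exists>f :: nat \<Rightarrow> nat. \<forall>A. A \<in> I \<longleftrightarrow> f -` A \<in> J)"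

text \<open>
  The space \<open>c0_ideal I\<close> depends on the ideal, so it is a subspace of a type rather than a type,
  and the library's type of bounded linear maps cannot serve as its dual. For a linear subspace
  \<open>X\<close> of a real normed space, \<open>dual_of X\<close> is the set of bounded linear functionals on \<open>X\<close> (with the
  norm inherited by \<open>X\<close>). Each functional is represented by the function that extends it by the
  junk value \<open>0\<close> outside \<open>X\<close>, so that equal functionals are equal functions and the vector space
  operations of the dual are pointwise.
\<close>

definition dual_of :: "'a::real_normed_vector set \<Rightarrow> ('a \<Rightarrow> real) set" where
  "dual_of X = {f.
     (\<forall>x \<in> X. \<forall>y \<in> X. f (x + y) = f x + f y) \<and>
     (\<forall>c. \<forall>x \<in> X. f (c *\<^sub>R x) = c * f x) \<and>
     (\<exists>K. \<forall>x \<in> X. \<bar>f x\<bar> \<le> K * norm x) \<and>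
     (\<forall>x. x \<notin> X \<longrightarrow> f x = 0)}"

definition dual_norm :: "'a::real_normed_vector set \<Rightarrow> ('a \<Rightarrow> real) \<Rightarrow> real" where
  "dual_norm X f = (SUP x \<in> {x \<in> X. norm x \<le> 1}. \<bar>f x\<bar>)"

text \<open>Only the values on \<open>dual_of X\<close> of an element of \<open>bidual_of X\<close> are meaningful.\<close>

definition bidual_of :: "'a::real_normed_vector set \<Rightarrow> (('a \<Rightarrow> real) \<Rightarrow> real) set" where
  "bidual_of X = {\<Phi>.
     (\<forall>f \<in> dual_of X. \<forall>g \<in> dual_of X. \<Phi> (\<lambda>x. f x + g x) = \<Phi> f + \<Phi> g) \<and>
     (\<forall>c. \<forall>f \<in> dual_of X. \<Phi> (\<lambda>x. c * f x) = c * \<Phi> f) \<and>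
     (\<exists>K. \<forall>f \<in> dual_of X. \<bar>\<Phi> f\<bar> \<le> K * dual_norm X f)}"

definition weak_star_null :: "'a::real_normed_vector set \<Rightarrow> (nat \<Rightarrow> 'a \<Rightarrow> real) \<Rightarrow> bool" where
  "weak_star_null X F \<longleftrightarrow> (\<forall>x \<in> X. (\<lambda>n. F n x) \<longlonglongrightarrow> 0)"

definition weakly_null_in_dual :: "'a::real_normed_vector set \<Rightarrow> (nat \<Rightarrow> 'a \<Rightarrow> real) \<Rightarrow> bool" where
  "weakly_null_in_dual X F \<longleftrightarrow> (\<forall>\<Phi> \<in> bidual_of X. (\<lambda>n. \<Phi> (F n)) \<longlonglongrightarrow> 0)"

definition grothendieck_space :: "'a::real_normed_vector set \<Rightarrow> bool" where
  "grothendieck_space X \<longleftrightarrow>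
     (\<forall>F. (\<forall>n. F n \<in> dual_of X) \<longrightarrow> weak_star_null X F \<longrightarrow> weakly_null_in_dual X F)"

text \<open>
  Since \<open>nat\<close> carries the discrete topology, the type of bounded continuous functions
  from \<open>nat\<close> to \<open>real\<close> with its supremum norm is the real Banach space of bounded sequences.
\<close>

definition c0_ideal :: "nat set set \<Rightarrow> (nat \<Rightarrow>\<^sub>C real) set" where
  "c0_ideal I = {x. \<forall>\<epsilon>>0. {n. \<bar>apply_bcontfun x n\<bar> \<ge> \<epsilon>} \<in> I}"

definition grothendieck_ideal :: "nat set set \<Rightarrow> bool" where
  "grothendieck_ideal I \<longleftrightarrow> grothendieck_space (c0_ideal I)"

lemma subspace_c0_ideal:
  assumes "omega_ideal I"
  shows "subspace (c0_ideal I)"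
proof (rule subspaceI)
  have fin: "{} \<in> I" and sub: "\<And>A B. A \<in> I \<Longrightarrow> B \<subseteq> A \<Longrightarrow> B \<in> I"
    and un: "\<And>A B. A \<in> I \<Longrightarrow> B \<in> I \<Longrightarrow> A \<union> B \<in> I"
    using assms unfolding omega_ideal_def by blast+
  show "0 \<in> c0_ideal I"
    using fin by (auto simp: c0_ideal_def not_le intro: sub)
  fix x y :: "nat \<Rightarrow>\<^sub>C real" assume x: "x \<in> c0_ideal I"
  { assume y: "y \<in> c0_ideal I"
    show "x + y \<in> c0_ideal I" unfolding c0_ideal_def
    proof (intro CollectI allI impI)
      fix e :: real assume "e > 0"
      then have "{n. \<bar>apply_bcontfun x n\<bar> \<ge> e/2} \<union> {n. \<bar>apply_bcontfun y n\<bar> \<ge> e/2} \<in> I"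
        using x y unfolding c0_ideal_def by (intro un) (use half_gt_zero in blast)+
      then show "{n. \<bar>apply_bcontfun (x + y) n\<bar> \<ge> e} \<in> I"
        by (rule sub) (auto simp: plus_bcontfun.rep_eq)
    qed }
  fix c :: real
  show "c *\<^sub>R x \<in> c0_ideal I" unfolding c0_ideal_def
  proof (intro CollectI allI impI)
    fix e :: real assume e: "e > 0"
    show "{n. \<bar>apply_bcontfun (c *\<^sub>R x) n\<bar> \<ge> e} \<in> I"
    proof (cases "c = 0")
      case True then show ?thesis using e fin by (simp add: not_le)
    next
      case False
      then have "{n. \<bar>apply_bcontfun x n\<bar> \<ge> e / \<bar>c\<bar>} \<in> I"
        using x e by (auto simp: c0_ideal_def)
      then show ?thesis
        by (rule sub) (use False in \<open>auto simp: scaleR_bcontfun.rep_eq abs_mult field_simps\<close>)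
    qed
  qed
qed

lemma closed_c0_ideal:
  assumes "omega_ideal I"
  shows "closed (c0_ideal I)"
proof -
  have sub: "\<And>A B. A \<in> I \<Longrightarrow> B \<subseteq> A \<Longrightarrow> B \<in> I"
    using assms unfolding omega_ideal_def by blast
  have "x \<in> c0_ideal I" if x: "x \<in> closure (c0_ideal I)" for x
    unfolding c0_ideal_def
  proof (intro CollectI allI impI)
    fix e :: real assume e: "e > 0"
    then obtain y where y: "y \<in> c0_ideal I" "dist y x < e/2"
      using x closure_approachable[of x "c0_ideal I"] half_gt_zero by blast
    have d: "\<bar>apply_bcontfun y n - apply_bcontfun x n\<bar> < e/2" for n
      using dist_bounded[of y n x] y(2) by (simp add: dist_real_def)
    have "\<bar>apply_bcontfun y n\<bar> \<ge> e/2" if "\<bar>apply_bcontfun x n\<bar> \<ge> e" for n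
      using that d[of n] by linarith
    moreover have "{n. \<bar>apply_bcontfun y n\<bar> \<ge> e/2} \<in> I"
      using y(1) e half_gt_zero unfolding c0_ideal_def by blast
    ultimately show "{n. \<bar>apply_bcontfun x n\<bar> \<ge> e} \<in> I"
      by (elim sub) auto
  qed
  then show ?thesis
    using closure_subset_eq by blast
qed

end

theory Submission
  imports Defs
begin

text \<open>
  Given \<open>I\<close>, the ideal \<open>J\<close> is the Fubini product of the ideal of finite sets with \<open>I\<close>: a subset of
  \<open>\<omega> \<times> \<omega>\<close> belongs to it if all but finitely many of its rows belong to \<open>I\<close>. The preimage of \<open>A\<close>
  under the second projection has all rows equal to \<open>A\<close>, so this projection witnesses
  \<open>I \<le> J\<close> in both orders.

  The reason why \<open>J\<close> is not Grothendieck is that the space of \<open>J\<close> contains a complemented copy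
  of \<open>c\<^sub>0\<close>. The copy is spanned by the indicators \<open>e\<^sub>n\<close> of the rows, and the projection comes from
  functionals \<open>F\<^sub>n\<close> that take a limit along the filter dual to \<open>I\<close> on the \<open>n\<close>-th row. Such limits
  of all bounded sequences exist by Tychonoff's theorem (\<open>generalized_limit\<close>). If \<open>x\<close> is in the space
  of \<open>J\<close>, then for each \<open>\<epsilon> > 0\<close> almost all rows of \<open>x\<close> are bounded by \<open>\<epsilon>\<close> outside a set in \<open>I\<close>, hence
  \<open>F\<^sub>n x\<close> tends to zero, that is, \<open>F\<close> is weak* null. But \<open>F\<close> is not weakly null, because
  \<open>f \<mapsto> (\<Sum>n. f e\<^sub>n)\<close> is a bounded functional on the dual with value 1 at each \<open>F\<^sub>n\<close>
  (\<open>biorthogonal_imp_not_grothendieck\<close>).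
\<close>

section \<open>Generalized limits along a filter\<close>

text \<open>
  On bounded functions, the evaluation functionals at points range over a product of compact
  intervals, so they have a cluster point \<open>L\<close> along \<open>G\<close>. Each relation below defines a closed
  set in the product topology and holds for the evaluations (for the last one, eventually along
  \<open>G\<close>), hence it passes to \<open>L\<close>.
\<close>

lemma generalized_limit:
  fixes G :: "'a::topological_space filter"
  assumes "G \<noteq> bot"
  shows "\<exists>L :: ('a \<Rightarrow>\<^sub>C real) \<Rightarrow> real.
    (\<forall>x y. L (x + y) = L x + L y) \<and>
    (\<forall>c x. L (c *\<^sub>R x) = c * L x) \<and>
    (\<forall>x. \<bar>L x\<bar> \<le> norm x) \<and>
    (\<forall>x C. closed C \<longrightarrow> eventually (\<lambda>i. apply_bcontfun x i \<in> C) G \<longrightarrow> L x \<in> C)"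
proof -
  define ev :: "'a \<Rightarrow> ('a \<Rightarrow>\<^sub>C real) \<Rightarrow> real" where "ev = (\<lambda>i x. apply_bcontfun x i)"
  define K :: "(('a \<Rightarrow>\<^sub>C real) \<Rightarrow> real) set" where "K = (\<Pi>\<^sub>E x\<in>UNIV. {- norm x..norm x})"
  have "compactin (product_topology (\<lambda>_. euclidean) UNIV) K"
    unfolding K_def by (subst compactin_PiE) auto
  then have "compact K"
    by (simp add: euclidean_product_topology)
  have abs_le: "\<bar>apply_bcontfun x i\<bar> \<le> norm x" for x :: "'a \<Rightarrow>\<^sub>C real" and i
    using norm_bounded[of x i] by simp
  have "- norm x \<le> apply_bcontfun x i \<and> apply_bcontfun x i \<le> norm x"
    for x :: "'a \<Rightarrow>\<^sub>C real" and i
    using abs_le[of x i] by linarith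
  then have "ev i \<in> K" for i
    by (simp add: K_def ev_def PiE_iff)
  then have "eventually (\<lambda>g. g \<in> K) (filtermap ev G)"
    by (simp add: eventually_filtermap)
  moreover have "filtermap ev G \<noteq> bot"
    using assms by (simp add: filtermap_bot_iff)
  ultimately obtain L where L: "inf (nhds L) (filtermap ev G) \<noteq> bot"
    using \<open>compact K\<close> unfolding compact_filter by blast
  have cluster: "L \<in> S" if S: "closed S" "eventually (\<lambda>i. ev i \<in> S) G" for S
  proof (rule ccontr)
    assume "L \<notin> S"
    then have "eventually (\<lambda>g. g \<in> - S) (nhds L)"
      using S(1) by (intro eventually_nhds_in_open) auto
    moreover have "eventually (\<lambda>g. g \<in> S) (filtermap ev G)"
      using S(2) by (simp add: eventually_filtermap)
    ultimately have "eventually (\<lambda>g. False) (inf (nhds L) (filtermap ev G))"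
      unfolding eventually_inf by (intro exI conjI) (assumption, assumption, simp)
    with L show False
      by (simp add: trivial_limit_def)
  qed
  note [continuous_intros] = continuous_on_product_coordinates
  show ?thesis
  proof (intro exI[of _ L] conjI allI impI)
    fix x y :: "'a \<Rightarrow>\<^sub>C real" and c :: real
    have "closed {g. g (x + y) = g x + (g y :: real)}"
      by (intro closed_Collect_eq continuous_intros)
    from cluster[OF this] show "L (x + y) = L x + L y"
      by (simp add: ev_def plus_bcontfun.rep_eq)
    have "closed {g. g (c *\<^sub>R x) = c * (g x :: real)}"
      by (intro closed_Collect_eq continuous_intros)
    from cluster[OF this] show "L (c *\<^sub>R x) = c * L x"
      by (simp add: ev_def scaleR_bcontfun.rep_eq)
    have "closed {g. \<bar>g x\<bar> \<le> norm x}"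
      by (intro closed_Collect_le continuous_intros)
    from cluster[OF this] show "\<bar>L x\<bar> \<le> norm x"
      by (simp add: ev_def abs_le)
  next
    fix x :: "'a \<Rightarrow>\<^sub>C real" and C
    assume "closed C" "eventually (\<lambda>i. apply_bcontfun x i \<in> C) G"
    moreover from \<open>closed C\<close> have "closed ((\<lambda>g. g x) -` C)"
      by (rule closed_vimage) (intro continuous_intros)
    ultimately show "L x \<in> C"
      using cluster[of "(\<lambda>g. g x) -` C"] by (simp add: ev_def)
  qed
qed

section \<open>Complemented copies of \<open>c\<^sub>0\<close>\<close>

lemma dual_of_sum:
  assumes "subspace X" "f \<in> dual_of X" "\<And>i. i \<in> A \<Longrightarrow> e i \<in> X"
  shows "f (\<Sum>i\<in>A. c i *\<^sub>R e i) = (\<Sum>i\<in>A. c i * f (e i))"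
  using assms(3)
proof (induction A rule: infinite_finite_induct)
  case (insert i A)
  then have "c i *\<^sub>R e i \<in> X" "(\<Sum>i\<in>A. c i *\<^sub>R e i) \<in> X"
    using assms(1) by (auto intro!: subspace_scale subspace_sum)
  with insert assms(2) show ?case
    by (auto simp: dual_of_def)
qed (use assms subspace_0[of X] in \<open>auto simp: dual_of_def dest: spec[of _ 0]\<close>)

lemma abs_le_dual_norm:
  assumes "f \<in> dual_of X" "x \<in> X" "norm x \<le> 1"
  shows "\<bar>f x\<bar> \<le> dual_norm X f"
proof -
  obtain K where K: "\<And>y. y \<in> X \<Longrightarrow> \<bar>f y\<bar> \<le> K * norm y"
    using assms(1) unfolding dual_of_def by blast
  have "\<bar>f y\<bar> \<le> \<bar>K\<bar>" if "y \<in> X" "norm y \<le> 1" for y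
  proof -
    have "K * norm y \<le> \<bar>K\<bar> * 1"
      using that(2) by (intro mult_mono) auto
    with K[OF that(1)] show ?thesis by simp
  qed
  then have "bdd_above ((\<lambda>y. \<bar>f y\<bar>) ` {y \<in> X. norm y \<le> 1})"
    by (auto intro!: bdd_aboveI)
  then show ?thesis
    unfolding dual_norm_def using assms by (intro cSUP_upper) auto
qed

text \<open>
  If the signed partial sums of \<open>e\<close> are bounded by 1, then choosing the signs of \<open>f (e n)\<close> shows
  that \<open>(f (e n))\<^sub>n\<close> is absolutely summable for each \<open>f\<close> in the dual, with \<open>\<ell>\<^sub>1\<close>-norm at most that
  of \<open>f\<close>. This makes \<open>f \<mapsto> (\<Sum>n. f (e n))\<close> an element of the bidual, and it takes the value 1 on
  every member of a system biorthogonal to \<open>e\<close>.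
\<close>

lemma biorthogonal_imp_not_grothendieck:
  fixes X :: "'a::real_normed_vector set"
  assumes X: "subspace X"
    and e: "\<And>n. e n \<in> X"
    and signed: "\<And>s N. (\<And>i. \<bar>s i\<bar> \<le> 1) \<Longrightarrow> norm (\<Sum>i<N. s i *\<^sub>R e i) \<le> 1"
    and F: "\<And>n. F n \<in> dual_of X" "weak_star_null X F"
    and biorth: "\<And>n m. F n (e m) = (if m = n then 1 else 0)"
  shows "\<not> grothendieck_space X"
proof
  assume groth: "grothendieck_space X"
  define \<Phi> where "\<Phi> = (\<lambda>f :: 'a \<Rightarrow> real. \<Sum>n. f (e n))"
  have partial: "(\<Sum>n<N. \<bar>f (e n)\<bar>) \<le> dual_norm X f" if f: "f \<in> dual_of X" for f N
  proof -
    let ?x = "\<Sum>n<N. sgn (f (e n)) *\<^sub>R e n"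
    have "(\<Sum>n<N. \<bar>f (e n)\<bar>) = f ?x"
      using dual_of_sum[OF X f, of "{..<N}" e] e by (simp add: abs_sgn mult.commute)
    also have "\<dots> \<le> \<bar>f ?x\<bar>" by simp
    also have "\<dots> \<le> dual_norm X f"
      using X e by (intro abs_le_dual_norm f subspace_sum subspace_scale signed)
        (auto simp: sgn_if)
    finally show ?thesis .
  qed
  have abs_summable: "summable (\<lambda>n. \<bar>f (e n)\<bar>)" if "f \<in> dual_of X" for f
  proof (rule bounded_imp_summable)
    show "(\<Sum>n\<le>N. \<bar>f (e n)\<bar>) \<le> dual_norm X f" for N
      using partial[OF that, of "Suc N"] by (simp only: lessThan_Suc_atMost)
  qed simp
  then have summable: "summable (\<lambda>n. f (e n))" if "f \<in> dual_of X" for f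
    by (intro summable_rabs_cancel[of "\<lambda>n. f (e n)"]) (use that in simp)
  have "\<bar>\<Phi> f\<bar> \<le> dual_norm X f" if f: "f \<in> dual_of X" for f
    unfolding \<Phi>_def
    using summable_rabs[OF abs_summable[OF f]] suminf_le_const[OF abs_summable[OF f] partial[OF f]]
    by linarith
  then have "\<Phi> \<in> bidual_of X"
    unfolding bidual_of_def
    by (auto simp: \<Phi>_def suminf_add summable suminf_mult intro!: exI[of _ 1])
  then have "(\<lambda>n. \<Phi> (F n)) \<longlonglongrightarrow> 0"
    using groth F by (auto simp: grothendieck_space_def weakly_null_in_dual_def)
  moreover have "\<Phi> (F n) = 1" for n
    using sums_single[of n "\<lambda>_. 1 :: real"] by (simp add: \<Phi>_def biorth sums_iff)
  ultimately show False
    by (simp add: LIMSEQ_const_iff)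
qed

section \<open>The Fubini product of the finite ideal with an ideal\<close>

lemma omega_ideal_cofilter:
  assumes "omega_ideal I"
  obtains G where "G \<noteq> bot" "\<And>P. eventually P G \<longleftrightarrow> {k. \<not> P k} \<in> I"
proof
  let ?G = "Abs_filter (\<lambda>P. {k. \<not> P k} \<in> I)"
  have sub: "\<And>A B. A \<in> I \<Longrightarrow> B \<subseteq> A \<Longrightarrow> B \<in> I"
    and un: "\<And>A B. A \<in> I \<Longrightarrow> B \<in> I \<Longrightarrow> A \<union> B \<in> I"
    and emp: "{} \<in> I" and univ: "UNIV \<notin> I"
    using assms unfolding omega_ideal_def by blast+
  have "is_filter (\<lambda>P. {k. \<not> P k} \<in> I)"
  proof
    show "{k. \<not> (P k \<and> Q k)} \<in> I" if "{k. \<not> P k} \<in> I" "{k. \<not> Q k} \<in> I" for P Q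
      by (rule sub[OF un[OF that]]) auto
    show "{k. \<not> Q k} \<in> I" if "\<forall>k. P k \<longrightarrow> Q k" "{k. \<not> P k} \<in> I" for P Q
      using that(1) by (intro sub[OF that(2)]) blast
  qed (use emp in simp)
  then show ev: "eventually P ?G \<longleftrightarrow> {k. \<not> P k} \<in> I" for P
    by (rule eventually_Abs_filter)
  show "?G \<noteq> bot"
    using univ ev[of "\<lambda>_. False"] by (auto simp: trivial_limit_def)
qed

text \<open>
  The product \<open>\<omega> \<times> \<omega>\<close> is coded on \<open>\<omega>\<close> by the pairing function, so the rows below are the vertical
  sections of the set of pairs coded by \<open>A\<close>.
\<close>

definition prod_row :: "nat set \<Rightarrow> nat \<Rightarrow> nat set" where
  "prod_row A n = {k. prod_encode (n, k) \<in> A}"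

definition fin_product :: "nat set set \<Rightarrow> nat set set" where
  "fin_product I = {A. finite {n. prod_row A n \<notin> I}}"

lemma omega_ideal_fin_product:
  assumes "omega_ideal I"
  shows "omega_ideal (fin_product I)"
proof -
  have sub: "\<And>A B. A \<in> I \<Longrightarrow> B \<subseteq> A \<Longrightarrow> B \<in> I"
    and un: "\<And>A B. A \<in> I \<Longrightarrow> B \<in> I \<Longrightarrow> A \<union> B \<in> I"
    and fin: "\<And>A. finite A \<Longrightarrow> A \<in> I" and univ: "UNIV \<notin> I"
    using assms unfolding omega_ideal_def by blast+
  show ?thesis
    unfolding omega_ideal_def
  proof (intro conjI allI impI)
    fix A :: "nat set" assume "finite A"
    then have "finite (prod_row A n)" for n
      using finite_vimageI[of A "\<lambda>k. prod_encode (n, k)"]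
      by (auto simp: prod_row_def vimage_def inj_def)
    then show "A \<in> fin_product I"
      using fin by (simp add: fin_product_def)
  next
    fix A B assume "A \<in> fin_product I" "B \<subseteq> A"
    then have "prod_row B n \<subseteq> prod_row A n" for n
      by (auto simp: prod_row_def)
    then show "B \<in> fin_product I"
      using \<open>A \<in> fin_product I\<close> sub unfolding fin_product_def
      by (auto elim!: rev_finite_subset)
  next
    fix A B assume "A \<in> fin_product I" "B \<in> fin_product I"
    then have "finite ({n. prod_row A n \<notin> I} \<union> {n. prod_row B n \<notin> I})"
      by (simp add: fin_product_def)
    moreover have "prod_row (A \<union> B) n = prod_row A n \<union> prod_row B n" for n
      by (auto simp: prod_row_def)
    then have "{n. prod_row (A \<union> B) n \<notin> I} \<subseteq> {n. prod_row A n \<notin> I} \<union> {n. prod_row B n \<notin> I}"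
      using un by auto
    ultimately show "A \<union> B \<in> fin_product I"
      unfolding fin_product_def mem_Collect_eq by (rule rev_finite_subset)
  next
    show "UNIV \<notin> fin_product I"
      using univ by (simp add: fin_product_def prod_row_def)
  qed
qed

text \<open>
  Every row of \<open>\<omega> \<times> A\<close> is \<open>A\<close>, so either all rows lie in \<open>I\<close> or infinitely many do not.
\<close>

lemma rudin_keisler_le_fin_product: "rudin_keisler_le I (fin_product I)"
proof -
  have "prod_row ((\<lambda>m. snd (prod_decode m)) -` A) n = A" for A n
    by (simp add: prod_row_def)
  then have "A \<in> I \<longleftrightarrow> (\<lambda>m. snd (prod_decode m)) -` A \<in> fin_product I" for A
    by (simp add: fin_product_def)
  then show ?thesis
    unfolding rudin_keisler_le_def by blast
qed

lemma rudin_keisler_le_imp_katetov_le: "rudin_keisler_le I J \<Longrightarrow> katetov_le I J"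
  by (auto simp: rudin_keisler_le_def katetov_le_def)

definition row_indicator :: "nat \<Rightarrow> (nat \<Rightarrow>\<^sub>C real)" where
  "row_indicator n = Bcontfun (\<lambda>m. if fst (prod_decode m) = n then 1 else 0)"

lemma apply_row_indicator:
  "apply_bcontfun (row_indicator n) m = (if fst (prod_decode m) = n then 1 else 0)"
proof -
  have "(\<lambda>m. if fst (prod_decode m) = n then 1 else 0 :: real) \<in> bcontfun"
    by (rule bcontfun_normI[where b = 1])
      (auto simp: continuous_on_def tendsto_def at_discrete)
  then show ?thesis
    by (simp add: row_indicator_def Bcontfun_inverse)
qed

lemma apply_sum_row_indicator:
  "apply_bcontfun (\<Sum>i<N. s i *\<^sub>R row_indicator i) m =
     (if fst (prod_decode m) < N then s (fst (prod_decode m)) else 0)"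
  by (induction N)
    (auto simp: plus_bcontfun.rep_eq scaleR_bcontfun.rep_eq apply_row_indicator less_Suc_eq)

text \<open>
  The functional \<open>F n\<close> below is a generalized limit along the copy of the filter dual to \<open>I\<close> on the
  \<open>n\<close>-th row. It is zero on the indicators of the other rows, which makes \<open>F\<close> biorthogonal to
  the row indicators, whose signed sums have sup-norm at most 1 because the rows are disjoint.
\<close>

lemma not_grothendieck_fin_product:
  assumes I: "omega_ideal I"
  shows "\<not> grothendieck_ideal (fin_product I)"
proof -
  let ?X = "c0_ideal (fin_product I)"
  obtain G where G: "G \<noteq> bot" "\<And>P. eventually P G \<longleftrightarrow> {k. \<not> P k} \<in> I"
    using omega_ideal_cofilter[OF I] by blast
  let ?G = "\<lambda>n. filtermap (\<lambda>k. prod_encode (n, k)) G"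
  have G_row: "?G n \<noteq> bot" for n
    using G(1) by (simp add: filtermap_bot_iff)
  obtain L :: "nat \<Rightarrow> (nat \<Rightarrow>\<^sub>C real) \<Rightarrow> real"
    where L_add: "\<And>n x y. L n (x + y) = L n x + L n y"
      and L_scale: "\<And>n c x. L n (c *\<^sub>R x) = c * L n x"
      and L_norm: "\<And>n x. \<bar>L n x\<bar> \<le> norm x"
      and L_closed: "\<And>n x C. closed C \<Longrightarrow>
        eventually (\<lambda>i. apply_bcontfun x i \<in> C) (?G n) \<Longrightarrow> L n x \<in> C"
    using generalized_limit[OF G_row] by metis
  have X: "subspace ?X"
    by (intro subspace_c0_ideal omega_ideal_fin_product I)
  have row_in: "row_indicator n \<in> ?X" for n
  proof -
    have "{} \<in> I"
      using I by (simp add: omega_ideal_def)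
    have "finite {m. prod_row {i. \<epsilon> \<le> \<bar>apply_bcontfun (row_indicator n) i\<bar>} m \<notin> I}" if "\<epsilon> > 0" for \<epsilon>
    proof (rule finite_subset)
      show "{m. prod_row {i. \<epsilon> \<le> \<bar>apply_bcontfun (row_indicator n) i\<bar>} m \<notin> I} \<subseteq> {n}"
        using \<open>{} \<in> I\<close> that by (auto simp: prod_row_def apply_row_indicator)
    qed simp
    then show ?thesis
      by (simp add: c0_ideal_def fin_product_def)
  qed
  \<comment> \<open>Elements of the dual vanish off the space by convention.\<close>
  define F where "F = (\<lambda>n x. if x \<in> ?X then L n x else 0)"
  have "\<not> grothendieck_space ?X"
  proof (rule biorthogonal_imp_not_grothendieck[OF X row_in])
    show "norm (\<Sum>i<N. s i *\<^sub>R row_indicator i) \<le> 1" if "\<And>i. \<bar>s i\<bar> \<le> 1" for s N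
      using that by (intro norm_bound) (simp add: apply_sum_row_indicator)
    show "F n \<in> dual_of ?X" for n
    proof -
      have "\<forall>x\<in>?X. \<forall>y\<in>?X. F n (x + y) = F n x + F n y"
        using subspace_add[OF X] by (simp add: F_def L_add)
      moreover have "\<forall>c. \<forall>x\<in>?X. F n (c *\<^sub>R x) = c * F n x"
        using subspace_scale[OF X] by (simp add: F_def L_scale)
      moreover have "\<forall>x\<in>?X. \<bar>F n x\<bar> \<le> 1 * norm x"
        by (simp add: F_def L_norm)
      moreover have "\<forall>x. x \<notin> ?X \<longrightarrow> F n x = 0"
        by (simp add: F_def)
      ultimately show ?thesis
        unfolding dual_of_def by blast
    qed
    show "F n (row_indicator m) = (if m = n then 1 else 0)" for n m
    proof -
      have "L n (row_indicator m) \<in> {if m = n then 1 else 0}"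
        by (rule L_closed) (auto simp: eventually_filtermap apply_row_indicator)
      then show ?thesis
        by (simp add: F_def row_in)
    qed
    show "weak_star_null ?X F"
      unfolding weak_star_null_def
    proof
      fix x assume x: "x \<in> ?X"
      show "(\<lambda>n. F n x) \<longlonglongrightarrow> 0"
      proof (rule LIMSEQ_I)
        fix r :: real assume r: "r > 0"
        let ?A = "{i. r / 2 \<le> \<bar>apply_bcontfun x i\<bar>}"
        have "?A \<in> fin_product I"
          using x r half_gt_zero[OF r] unfolding c0_ideal_def by blast
        then have "eventually (\<lambda>n. prod_row ?A n \<in> I) sequentially"
          unfolding fin_product_def
          by (simp only: mem_Collect_eq eventually_cofinite flip: cofinite_eq_sequentially)
        then obtain N where N: "\<And>n. n \<ge> N \<Longrightarrow> prod_row ?A n \<in> I"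
          by (auto simp: eventually_sequentially)
        have "norm (F n x - 0) < r" if "n \<ge> N" for n
        proof -
          have "eventually (\<lambda>i. \<bar>apply_bcontfun x i\<bar> < r / 2) (?G n)"
            using N[OF that] by (simp add: eventually_filtermap G(2) prod_row_def not_less)
          then have "L n x \<in> {- (r / 2)..r / 2}"
            by (intro L_closed) (auto elim!: eventually_mono)
          then show ?thesis
            using r x by (auto simp: F_def abs_less_iff)
        qed
        then show "\<exists>N. \<forall>n\<ge>N. norm (F n x - 0) < r"
          by blast
      qed
    qed
  qed
  then show ?thesis
    by (simp add: grothendieck_ideal_def)
qed

theorem corollary2p14:
  "(\<forall>I. omega_ideal I \<longrightarrow>
      (\<exists>J. omega_ideal J \<and> \<not> grothendieck_ideal J \<and> rudin_keisler_le I J)) \<and>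
   (\<forall>I. omega_ideal I \<longrightarrow>
      (\<exists>J. omega_ideal J \<and> \<not> grothendieck_ideal J \<and> katetov_le I J))"
  using omega_ideal_fin_product not_grothendieck_fin_product rudin_keisler_le_fin_product
    rudin_keisler_le_imp_katetov_le by blast

end
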